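(* Let $X$ be a spectral $C$-representation of $A$, and let $Z$ be a minimal $C$-representation of $A$ in $X$. Then the spectral and patch subspace topologies agree on $Z$, and the following are equivalent for $B \in Z$. (1) $B$ is irredundant in $Z$. (2) $B$ is strongly irredundant in $Z$. (3) $B$ is isolated in the spectral (equivalently, patch) subspace topology on $Z$.
   Context: $A, C, D$ are nonempty sets with $A \subsetneq C \subseteq D$ (no algebraic structure is assumed). A collection $Z$ of subsets of $D$ is a $C$-representation of $A$ if $A = (\bigcap_{B \in Z} B) \cap C$ (an empty intersection is $D$). A spectral space is a $T_0$ space having a basis of quasicompact open sets closed under finite intersections and in which every irreducible closed subset has a unique generic point (a finite intersection includes the empty one, so the space is quasicompact). Its specialization order is: $x \le y$ iff $y \in \overline{\{x\}}$. For a subset $Y$, $\mathrm{Min}\, Y$ is the set of elements of $Y$ minimal under $\le$. The patch topology on a spectral space is the topology having as a subbasis of open sets the quasicompact open sets and their complements. For a $C$-representation $X$ of $A$ and $F \subseteq D$, put $\mathcal V(F) = \{B \in X : F \subseteq B\}$ and $\mathcal U(F) = \{B \in X : F \not\subseteq B\}$; write $\mathcal U(d)=\mathcal U(\{d\})$. The $C$-representation $X$ is spectral if $X$ is (equipped with a topology making it) a spectral space and $\{\mathcal U(d) : d \in D\}$ is a subbasis for $X$ consisting of quasicompact open sets. Then the specialization order on $X$ is set inclusion. Let $Z \subseteq X$ be a $C$-representation of $A$ and $B \in Z$. $B$ is irredundant in $Z$ if $Z \setminus \{B\}$ is not a $C$-representation of $A$. $B$ is strongly irredundant in $Z$ if the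 only closed subset $Y$ of $\mathcal V(B)$ such that $(Z \setminus \{B\}) \cup Y$ is a $C$-representation of $A$ is $Y = \mathcal V(B)$. A minimal closed $C$-representation of $A$ in $X$ is a closed subset of $X$ that is minimal under inclusion among the closed subsets of $X$ that are $C$-representations of $A$. A minimal $C$-representation of $A$ in $X$ is a subspace of the form $\mathrm{Min}\, Y$ for some minimal closed $C$-representation $Y$ of $A$ in $X$. *)

theory Defs
  imports "HOL-Analysis.Analysis"
begin

section \<open>Spectral spaces\<close>

definition irreducible_closedin :: "'a topology \<Rightarrow> 'a set \<Rightarrow> bool" where
  "irreducible_closedin T F \<longleftrightarrow> closedin T F \<and> F \<noteq> {} \<and>
     (\<forall>G H. closedin T G \<longrightarrow> closedin T H \<longrightarrow> F = G \<union> H \<longrightarrow> F = G \<or> F = H)"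

text \<open>Taking \<open>\<F> = {}\<close> puts the whole space into the basis, so spectral spaces are quasicompact.\<close>

definition spectral_space :: "'a topology \<Rightarrow> bool" where
  "spectral_space T \<longleftrightarrow> t0_space T \<and>
     (\<exists>\<B>. openin T = arbitrary union_of (\<lambda>U. U \<in> \<B>) \<and>
          (\<forall>U\<in>\<B>. compactin T U) \<and>
          (\<forall>\<F>. finite \<F> \<and> \<F> \<subseteq> \<B> \<longrightarrow> topspace T \<inter> \<Inter>\<F> \<in> \<B>)) \<and>
     (\<forall>F. irreducible_closedin T F \<longrightarrow> (\<exists>!x. x \<in> topspace T \<and> T closure_of {x} = F))"

definition specializes_to :: "'a topology \<Rightarrow> 'a \<Rightarrow> 'a \<Rightarrow> bool" where
  "specializes_to T x y \<longleftrightarrow> y \<in> T closure_of {x}"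

text \<open>\<open>specializes_to T x y\<close> is \<open>x \<le> y\<close> in the specialization order.\<close>

definition Min_of :: "'a topology \<Rightarrow> 'a set \<Rightarrow> 'a set" where
  "Min_of T Y = {y \<in> Y. \<forall>z\<in>Y. specializes_to T z y \<longrightarrow> z = y}"

text \<open>Here \<open>relative_to\<close> makes the empty intersection the whole space \<open>topspace T\<close>.\<close>

definition subbase_for :: "'a set set \<Rightarrow> 'a topology \<Rightarrow> bool" where
  "subbase_for \<S> T \<longleftrightarrow>
     openin T = arbitrary union_of (finite intersection_of (\<lambda>U. U \<in> \<S>) relative_to topspace T)"

definition patch_topology :: "'a topology \<Rightarrow> 'a topology" where
  "patch_topology T = topology (arbitrary union_of
     (finite intersection_of
        (\<lambda>S. \<exists>U. openin T U \<and> compactin T U \<and> (S = U \<or> S = topspace T - U))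
      relative_to topspace T))"

section \<open>\<open>C\<close>-representations\<close>

text \<open>The factor \<open>D\<close> implements the convention that an empty intersection is \<open>D\<close>.\<close>

definition crep :: "'a set \<Rightarrow> 'a set \<Rightarrow> 'a set \<Rightarrow> 'a set set \<Rightarrow> bool" where
  "crep A C D Z \<longleftrightarrow> Z \<subseteq> Pow D \<and> A = (D \<inter> \<Inter>Z) \<inter> C"

definition V_set :: "'a set set \<Rightarrow> 'a set \<Rightarrow> 'a set set" where
  "V_set X F = {B \<in> X. F \<subseteq> B}"

definition U_set :: "'a set set \<Rightarrow> 'a set \<Rightarrow> 'a set set" where
  "U_set X F = {B \<in> X. \<not> F \<subseteq> B}"

definition spectral_crep ::
    "'a set \<Rightarrow> 'a set \<Rightarrow> 'a set \<Rightarrow> 'a set set \<Rightarrow> 'a set topology \<Rightarrow> bool" where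
  "spectral_crep A C D X T \<longleftrightarrow>
     crep A C D X \<and> topspace T = X \<and> spectral_space T \<and>
     subbase_for {U_set X {d} | d. d \<in> D} T \<and>
     (\<forall>d\<in>D. openin T (U_set X {d}) \<and> compactin T (U_set X {d}))"

definition irredundant_in :: "'a set \<Rightarrow> 'a set \<Rightarrow> 'a set \<Rightarrow> 'a set set \<Rightarrow> 'a set \<Rightarrow> bool" where
  "irredundant_in A C D Z B \<longleftrightarrow> \<not> crep A C D (Z - {B})"

text \<open>The equivalence says that \<open>V_set (topspace T) B\<close> is the only such \<open>Y\<close>; in a spectral
  \<open>C\<close>-representation it always is one. For \<open>irredundant_in\<close> and \<open>strongly_irredundant_in\<close>, \<open>Z\<close> is
  meant to be a \<open>C\<close>-representation with \<open>B \<in> Z\<close>.\<close>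

definition strongly_irredundant_in ::
    "'a set \<Rightarrow> 'a set \<Rightarrow> 'a set \<Rightarrow> 'a set topology \<Rightarrow> 'a set set \<Rightarrow> 'a set \<Rightarrow> bool" where
  "strongly_irredundant_in A C D T Z B \<longleftrightarrow>
     (\<forall>Y. closedin (subtopology T (V_set (topspace T) B)) Y \<and> crep A C D ((Z - {B}) \<union> Y)
          \<longleftrightarrow> Y = V_set (topspace T) B)"

definition minimal_closed_crep ::
    "'a set \<Rightarrow> 'a set \<Rightarrow> 'a set \<Rightarrow> 'a set topology \<Rightarrow> 'a set set \<Rightarrow> bool" where
  "minimal_closed_crep A C D T Y \<longleftrightarrow>
     closedin T Y \<and> crep A C D Y \<and>
     (\<forall>Y'. closedin T Y' \<and> crep A C D Y' \<and> Y' \<subseteq> Y \<longrightarrow> Y' = Y)"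

definition minimal_crep ::
    "'a set \<Rightarrow> 'a set \<Rightarrow> 'a set \<Rightarrow> 'a set topology \<Rightarrow> 'a set set \<Rightarrow> bool" where
  "minimal_crep A C D T Z \<longleftrightarrow> (\<exists>Y. minimal_closed_crep A C D T Y \<and> Z = Min_of T Y)"

end

(* The specialization order of a spectral representation is inclusion, and patch compactness makes
   d in B, for B minimal in a closed set Y, hold throughout Y on a spectral neighbourhood of B:
   otherwise some P in Y would lie in every spectral neighbourhood of B, hence be contained in B,
   while omitting d. This gives the agreement of the two topologies on Min Y.
   An irredundant B is isolated by U(c) for some c in C - A. If U isolates B and the closed set W,
   properly contained in V(B), could replace B, then (Y - U) Un W would be a smaller closed
   representation than Y. *)
theory Submission
  imports Defs
begin

section \<open>Spectral spaces\<close>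

text \<open>Zorn's lemma for reverse inclusion. The hypothesis also covers the empty chain, which is
  what makes \<open>\<A>\<close> nonempty; hence the split on the empty chain in both
  applications.\<close>

lemma Zorn_descending:
  fixes \<A> :: "'b set set"
  assumes lower: "\<And>C. C \<subseteq> \<A> \<Longrightarrow> (\<And>a b. a \<in> C \<Longrightarrow> b \<in> C \<Longrightarrow> a \<subseteq> b \<or> b \<subseteq> a) \<Longrightarrow> \<exists>L\<in>\<A>. \<forall>c\<in>C. L \<subseteq> c"
  obtains m where "m \<in> \<A>" "\<And>a. a \<in> \<A> \<Longrightarrow> a \<subseteq> m \<Longrightarrow> a = m"
proof -
  have "\<exists>m\<in>\<A>. \<forall>a\<in>\<A>. m \<supseteq> a \<longrightarrow> a = m"
  proof (rule predicate_Zorn)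
    show "partial_order_on \<A> (relation_of (\<supseteq>) \<A>)"
      by (rule partial_order_on_relation_ofI) auto
  next
    fix C
    assume C: "C \<in> Chains (relation_of (\<supseteq>) \<A>)"
    show "\<exists>u\<in>\<A>. \<forall>a\<in>C. a \<supseteq> u"
      by (rule lower) (use C in \<open>auto simp: Chains_def relation_of_def\<close>)
  qed
  then show ?thesis using that by blast
qed

text \<open>Serves to replace a finite subfamily of a chain by a single member, its least
  one.\<close>

lemma finite_chain_Inter_mem:
  assumes "finite \<F>" "\<F> \<noteq> {}" "\<And>a b. a \<in> \<F> \<Longrightarrow> b \<in> \<F> \<Longrightarrow> a \<subseteq> b \<or> b \<subseteq> a"
  shows "\<Inter>\<F> \<in> \<F>"
  using assms
proof (induction rule: finite_ne_induct)
  case (insert F \<F>)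
  then have "\<Inter>\<F> \<in> \<F>" by blast
  with insert.prems[of F "\<Inter>\<F>"] have "F \<subseteq> \<Inter>\<F> \<or> \<Inter>\<F> \<subseteq> F" by blast
  then have "F \<inter> \<Inter>\<F> = F \<or> F \<inter> \<Inter>\<F> = \<Inter>\<F>" by blast
  with \<open>\<Inter>\<F> \<in> \<F>\<close> show ?case by auto
qed simp

section \<open>Quasicompact open sets and patch compactness\<close>

lemma spectral_spaceE:
  assumes "spectral_space T"
  obtains \<B> where "openin T = arbitrary union_of (\<lambda>U. U \<in> \<B>)"
    "\<And>U. U \<in> \<B> \<Longrightarrow> compactin T U"
    "\<And>\<F>. finite \<F> \<Longrightarrow> \<F> \<subseteq> \<B> \<Longrightarrow> topspace T \<inter> \<Inter>\<F> \<in> \<B>"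
proof -
  have "\<exists>\<B>. openin T = arbitrary union_of (\<lambda>U. U \<in> \<B>) \<and> (\<forall>U\<in>\<B>. compactin T U) \<and>
      (\<forall>\<F>. finite \<F> \<and> \<F> \<subseteq> \<B> \<longrightarrow> topspace T \<inter> \<Inter>\<F> \<in> \<B>)"
    using assms unfolding spectral_space_def by (elim conjE)
  then obtain \<B> where \<B>: "openin T = arbitrary union_of (\<lambda>U. U \<in> \<B>)" "\<forall>U\<in>\<B>. compactin T U"
      "\<forall>\<F>. finite \<F> \<and> \<F> \<subseteq> \<B> \<longrightarrow> topspace T \<inter> \<Inter>\<F> \<in> \<B>"
    by (elim exE conjE)
  show ?thesis by (rule that[OF \<B>(1)]) (use \<B>(2,3) in blast)+
qed

text \<open>By quasicompactness each of \<open>U\<close> and \<open>V\<close> is a finite union of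
  basis members. Distributing, \<open>U \<inter> V\<close> is a finite union of pairwise
  intersections, which are again basis members and so quasicompact.\<close>

lemma spectral_space_compactin_Int:
  assumes "spectral_space T" "openin T U" "compactin T U" "openin T V" "compactin T V"
  shows "compactin T (U \<inter> V)"
proof -
  obtain \<B> where \<B>: "openin T = arbitrary union_of (\<lambda>U. U \<in> \<B>)"
      "\<And>U. U \<in> \<B> \<Longrightarrow> compactin T U"
      "\<And>\<F>. finite \<F> \<Longrightarrow> \<F> \<subseteq> \<B> \<Longrightarrow> topspace T \<inter> \<Inter>\<F> \<in> \<B>"
    using spectral_spaceE[OF assms(1)] by metis
  have \<B>_open: "openin T U" if "U \<in> \<B>" for U
    using that unfolding \<B>(1) by (simp add: arbitrary_union_of_inc)
  have finite_union: "\<exists>\<F>. finite \<F> \<and> \<F> \<subseteq> \<B> \<and> W = \<Union>\<F>" if W: "openin T W" "compactin T W" for W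
  proof -
    obtain \<U> where \<U>: "\<U> \<subseteq> \<B>" "\<Union>\<U> = W"
      using W(1) unfolding \<B>(1) union_of_def by (auto simp: arbitrary_def)
    have "\<exists>\<F>. finite \<F> \<and> \<F> \<subseteq> \<U> \<and> W \<subseteq> \<Union>\<F>"
      by (rule compactinD[OF W(2)]) (use \<U> \<B>_open in auto)
    then obtain \<F> where \<F>: "finite \<F>" "\<F> \<subseteq> \<U>" "W \<subseteq> \<Union>\<F>"
      by (elim exE conjE)
    have "W = \<Union>\<F>" using \<U>(2) \<F>(2,3) by auto
    moreover have "\<F> \<subseteq> \<B>" using \<U>(1) \<F>(2) by simp
    ultimately show ?thesis using \<F>(1) by (intro exI[of _ \<F>] conjI)
  qed
  obtain \<F> where \<F>: "finite \<F>" "\<F> \<subseteq> \<B>" "U = \<Union>\<F>"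
    using finite_union[OF assms(2,3)] by (elim exE conjE)
  obtain \<G> where \<G>: "finite \<G>" "\<G> \<subseteq> \<B>" "V = \<Union>\<G>"
    using finite_union[OF assms(4,5)] by (elim exE conjE)
  have "compactin T (F \<inter> G)" if "F \<in> \<B>" "G \<in> \<B>" for F G
  proof -
    have "topspace T \<inter> \<Inter>{F, G} = F \<inter> G"
      using \<B>_open[OF that(1)] openin_subset by auto
    moreover have "topspace T \<inter> \<Inter>{F, G} \<in> \<B>" by (rule \<B>(3)) (use that in auto)
    ultimately show ?thesis using \<B>(2) by simp
  qed
  then have "compactin T (\<Union>((\<lambda>(F, G). F \<inter> G) ` (\<F> \<times> \<G>)))"
    using \<F> \<G> by (intro compactin_Union) auto
  moreover have "\<Union>((\<lambda>(F, G). F \<inter> G) ` (\<F> \<times> \<G>)) = U \<inter> V"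
    unfolding \<F>(3) \<G>(3) by auto
  ultimately show ?thesis by simp
qed

text \<open>The factor \<open>topspace T\<close> gives the empty family its meaning. That base case
  is quasicompactness of the whole space, obtained from the empty intersection being in the
  basis.\<close>

lemma spectral_space_compactin_Inter:
  assumes T: "spectral_space T" and "finite \<F>"
    and \<F>: "\<And>U. U \<in> \<F> \<Longrightarrow> openin T U \<and> compactin T U"
  shows "openin T (topspace T \<inter> \<Inter>\<F>) \<and> compactin T (topspace T \<inter> \<Inter>\<F>)"
  using assms(2) \<F>
proof (induction rule: finite_induct)
  case empty
  obtain \<B> where "\<And>U. U \<in> \<B> \<Longrightarrow> compactin T U"
      "\<And>\<F>. finite \<F> \<Longrightarrow> \<F> \<subseteq> \<B> \<Longrightarrow> topspace T \<inter> \<Inter>\<F> \<in> \<B>"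
    using spectral_spaceE[OF T] by metis
  then show ?case by (metis Inter_empty empty_subsetI finite.emptyI inf_top.right_neutral openin_topspace)
next
  case (insert U \<F>)
  have "topspace T \<inter> \<Inter>(insert U \<F>) = U \<inter> (topspace T \<inter> \<Inter>\<F>)" by auto
  then show ?case using insert spectral_space_compactin_Int[OF T] by (metis insert_iff openin_Int)
qed

text \<open>A form of patch compactness. The generic point of a minimal closed subset of \<open>Y\<close> that still
  meets every finite intersection of \<open>\<K>\<close> is the required point.\<close>

lemma spectral_space_fip:
  assumes T: "spectral_space T" and Y: "closedin T Y"
    and \<K>: "\<And>K. K \<in> \<K> \<Longrightarrow> openin T K \<and> compactin T K"
    and fip: "\<And>\<F>. finite \<F> \<Longrightarrow> \<F> \<subseteq> \<K> \<Longrightarrow> Y \<inter> \<Inter>\<F> \<noteq> {}"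
  obtains x where "x \<in> Y" "\<And>K. K \<in> \<K> \<Longrightarrow> x \<in> K"
proof -
  define \<A> where "\<A> = {F. closedin T F \<and> F \<subseteq> Y \<and> (\<forall>\<F>. finite \<F> \<and> \<F> \<subseteq> \<K> \<longrightarrow> F \<inter> \<Inter>\<F> \<noteq> {})}"
  have "Y \<in> \<A>" using Y fip by (auto simp: \<A>_def)
  obtain F where F: "F \<in> \<A>" and F_min: "\<And>G. G \<in> \<A> \<Longrightarrow> G \<subseteq> F \<Longrightarrow> G = F"
  proof (rule Zorn_descending[of \<A>])
    fix C
    assume C: "C \<subseteq> \<A>" and chain: "\<And>a b. a \<in> C \<Longrightarrow> b \<in> C \<Longrightarrow> a \<subseteq> b \<or> b \<subseteq> a"
    show "\<exists>L\<in>\<A>. \<forall>c\<in>C. L \<subseteq> c"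
    proof (cases "C = {}")
      case True
      then show ?thesis using \<open>Y \<in> \<A>\<close> by blast
    next
      case False
      have clos: "closedin T c" if "c \<in> C" for c using C that by (auto simp: \<A>_def)
      \<comment> \<open>Since \<open>?K\<close> is quasicompact, it suffices that it meets the
        intersection of each finite subfamily of the closed chain. Such an intersection contains
        some member \<open>c\<close> of the chain, and \<open>c\<close> meets
        \<open>\<Inter>\<F>\<close> because it belongs to \<open>\<A>\<close>.\<close>
      have "\<Inter>C \<inter> \<Inter>\<F> \<noteq> {}" if \<F>: "finite \<F>" "\<F> \<subseteq> \<K>" for \<F>
      proof -
        let ?K = "topspace T \<inter> \<Inter>\<F>"
        have "compactin T ?K"
          using spectral_space_compactin_Inter[OF T \<F>(1)] \<K> \<F> by blast
        moreover have "?K \<inter> \<Inter>\<G> \<noteq> {}" if \<G>: "finite \<G>" "\<G> \<subseteq> C" for \<G>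
        proof -
          obtain c where c: "c \<in> C" "c \<subseteq> \<Inter>\<G>"
          proof (cases "\<G> = {}")
            case True
            then show ?thesis using \<open>C \<noteq> {}\<close> that by auto
          next
            case False
            have "\<Inter>\<G> \<in> \<G>" by (rule finite_chain_Inter_mem) (use \<G> False chain in auto)
            then show ?thesis using \<G> that by blast
          qed
          have "c \<inter> \<Inter>\<F> \<noteq> {}" using c C \<F> by (auto simp: \<A>_def)
          then show ?thesis using c closedin_subset[OF clos[OF c(1)]] by blast
        qed
        ultimately have "?K \<inter> \<Inter>C \<noteq> {}" using clos unfolding compactin_fip by blast
        then show ?thesis by blast
      qed
      moreover have "closedin T (\<Inter>C)" using False clos by (rule closedin_Inter)
      moreover have "\<Inter>C \<subseteq> Y" using False C unfolding \<A>_def by blast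
      ultimately have "\<Inter>C \<in> \<A>" by (simp add: \<A>_def)
      then show ?thesis by blast
    qed
  qed (rule that)
  have F_props: "closedin T F" "F \<subseteq> Y" and
    F_fip: "\<And>\<F>. finite \<F> \<Longrightarrow> \<F> \<subseteq> \<K> \<Longrightarrow> F \<inter> \<Inter>\<F> \<noteq> {}"
    using F by (auto simp: \<A>_def)
  have "irreducible_closedin T F"
    unfolding irreducible_closedin_def
  proof (intro conjI allI impI)
    show "F \<noteq> {}" using F_fip[of "{}"] by auto
  next
    fix G H
    assume GH: "closedin T G" "closedin T H" "F = G \<union> H"
    \<comment> \<open>If both pieces lost the intersection property, two finite subfamilies would
      witness this, and their union would witness it for \<open>F\<close>.\<close>
    have "G \<in> \<A> \<or> H \<in> \<A>"
    proof (rule ccontr)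
      assume "\<not> ?thesis"
      then obtain \<F> \<G> where "finite \<F>" "\<F> \<subseteq> \<K>" "G \<inter> \<Inter>\<F> = {}" "finite \<G>" "\<G> \<subseteq> \<K>" "H \<inter> \<Inter>\<G> = {}"
        using GH F_props unfolding \<A>_def by blast
      then show False using F_fip[of "\<F> \<union> \<G>"] GH(3) by auto
    qed
    then show "F = G \<or> F = H" using F_min GH(3) by blast
  qed (fact F_props)
  moreover have "\<forall>F. irreducible_closedin T F \<longrightarrow> (\<exists>!x. x \<in> topspace T \<and> T closure_of {x} = F)"
    using T unfolding spectral_space_def by (elim conjE)
  ultimately obtain x where x: "x \<in> topspace T" "T closure_of {x} = F" by blast
  have "x \<in> F" using x closure_of_subset[of "{x}" T] by auto
  \<comment> \<open>An open set that meets the closure of \<open>{x}\<close> contains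
    \<open>x\<close>; \<open>F_fip\<close> for \<open>{K}\<close> supplies the common point.\<close>
  moreover have "x \<in> K" if "K \<in> \<K>" for K
  proof -
    have "F \<inter> \<Inter>{K} \<noteq> {}" by (rule F_fip) (use that in auto)
    then obtain y where "y \<in> T closure_of {x}" "y \<in> K" using x(2) by auto
    then show ?thesis using \<K>[OF that] by (auto simp: in_closure_of)
  qed
  ultimately show ?thesis using that F_props by blast
qed

section \<open>Spectral representations\<close>

lemma spectral_crepD:
  assumes "spectral_crep A C D X T"
  shows "topspace T = X" "X \<subseteq> Pow D" "A = D \<inter> \<Inter>X \<inter> C" "spectral_space T"
    "subbase_for {U_set X {d} | d. d \<in> D} T"
    "\<And>d. d \<in> D \<Longrightarrow> openin T (U_set X {d}) \<and> compactin T (U_set X {d})"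
proof -
  have X: "(X \<subseteq> Pow D \<and> A = D \<inter> \<Inter>X \<inter> C) \<and> topspace T = X \<and> spectral_space T \<and>
      subbase_for {U_set X {d} | d. d \<in> D} T \<and>
      (\<forall>d\<in>D. openin T (U_set X {d}) \<and> compactin T (U_set X {d}))"
    using assms unfolding spectral_crep_def crep_def .
  show "topspace T = X" using X by (elim conjE)
  show "X \<subseteq> Pow D" using X by (elim conjE)
  show "A = D \<inter> \<Inter>X \<inter> C" using X by (elim conjE)
  show "spectral_space T" using X by (elim conjE)
  show "subbase_for {U_set X {d} | d. d \<in> D} T" using X by (elim conjE)
  show "openin T (U_set X {d}) \<and> compactin T (U_set X {d})" if "d \<in> D" for d
    using X that by (elim conjE) (rule bspec)
qed

section \<open>Neighbourhoods, inclusion and closed sets\<close>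

text \<open>A finite intersection of sets U(d) consists of the members disjoint from the finite set
  \<open>G\<close> of indices d; the empty \<open>G\<close> stands for the whole space.
  Neighbourhoods are handled in this form from here on.\<close>

lemma spectral_crep_nbhd:
  assumes X: "spectral_crep A C D X T" and U: "openin T U" "B \<in> U"
  obtains G where "finite G" "G \<subseteq> D" "G \<inter> B = {}" "\<And>P. P \<in> X \<Longrightarrow> P \<inter> G = {} \<Longrightarrow> P \<in> U"
proof -
  note XD = spectral_crepD[OF X]
  have "(arbitrary union_of
      (finite intersection_of (\<lambda>U. U \<in> {U_set X {d} | d. d \<in> D}) relative_to topspace T)) U"
    using XD(5) U(1) unfolding subbase_for_def by simp
  then have "\<exists>W. (finite intersection_of (\<lambda>U. U \<in> {U_set X {d} | d. d \<in> D}) relative_to topspace T) W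
      \<and> B \<in> W \<and> W \<subseteq> U"
    using U(2) unfolding arbitrary_union_of_alt by (rule bspec)
  then obtain \<F> where \<F>: "finite \<F>" "\<F> \<subseteq> {U_set X {d} | d. d \<in> D}"
      "B \<in> X \<inter> \<Inter>\<F>" "X \<inter> \<Inter>\<F> \<subseteq> U"
    unfolding relative_to_def intersection_of_def XD(1) by auto
  have "\<F> \<subseteq> (\<lambda>d. U_set X {d}) ` D" using \<F>(2) by auto
  then obtain G where G: "G \<subseteq> D" "finite G" "\<F> = (\<lambda>d. U_set X {d}) ` G"
    using finite_subset_image[OF \<F>(1)] by metis
  show ?thesis
    by (rule that[of G]) (use G \<F> in \<open>auto simp: U_set_def\<close>)
qed

lemma spectral_crep_openin_avoid:
  assumes X: "spectral_crep A C D X T" and "finite G" "G \<subseteq> D"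
  shows "openin T {P \<in> X. P \<inter> G = {}}"
proof -
  note XD = spectral_crepD[OF X]
  have "openin T (topspace T \<inter> \<Inter>((\<lambda>d. U_set X {d}) ` G))"
    using spectral_space_compactin_Inter[OF XD(4), of "(\<lambda>d. U_set X {d}) ` G"] assms(2,3) XD(6) by blast
  also have "topspace T \<inter> \<Inter>((\<lambda>d. U_set X {d}) ` G) = {P \<in> X. P \<inter> G = {}}"
    by (auto simp: U_set_def XD(1))
  finally show ?thesis .
qed

text \<open>Disjointness from \<open>G\<close> passes to subsets, so every neighbourhood of
  \<open>Q\<close> also contains \<open>P\<close>; hence the complement of \<open>Y\<close> cannot
  be one.\<close>

lemma spectral_crep_closedin_upward:
  assumes X: "spectral_crep A C D X T" and Y: "closedin T Y" and "P \<in> Y" "P \<subseteq> Q" "Q \<in> X"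
  shows "Q \<in> Y"
proof (rule ccontr)
  assume "Q \<notin> Y"
  then have "openin T (X - Y)" "Q \<in> X - Y"
    using Y assms spectral_crepD(1)[OF X] by (auto simp: closedin_def)
  then obtain G where G: "G \<inter> Q = {}" "\<And>P. P \<in> X \<Longrightarrow> P \<inter> G = {} \<Longrightarrow> P \<in> X - Y"
    using spectral_crep_nbhd[OF X] by metis
  have "P \<in> X" using assms closedin_subset[OF Y] spectral_crepD(1)[OF X] by auto
  then show False using G assms by blast
qed

text \<open>If \<open>d\<close> lay in \<open>P\<close> but not in \<open>Q\<close>, then U(d) would
  be a neighbourhood of \<open>Q\<close> missing \<open>P\<close>. Conversely, the closure of
  \<open>{P}\<close> is a closed set, so it contains every member of \<open>X\<close> above
  \<open>P\<close>.\<close>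

lemma specializes_to_iff_subset:
  assumes X: "spectral_crep A C D X T" and "P \<in> X" "Q \<in> X"
  shows "specializes_to T P Q \<longleftrightarrow> P \<subseteq> Q"
proof
  note XD = spectral_crepD[OF X]
  assume spec: "specializes_to T P Q"
  show "P \<subseteq> Q"
  proof
    fix d
    assume "d \<in> P"
    then have "d \<in> D" using XD(2) assms(2) by auto
    show "d \<in> Q"
    proof (rule ccontr)
      assume "d \<notin> Q"
      then have "Q \<in> U_set X {d}" using assms(3) by (simp add: U_set_def)
      then have "P \<in> U_set X {d}"
        using spec XD(6)[OF \<open>d \<in> D\<close>] unfolding specializes_to_def in_closure_of by blast
      then show False using \<open>d \<in> P\<close> by (auto simp: U_set_def)
    qed
  qed
next
  assume "P \<subseteq> Q"
  moreover have "P \<in> T closure_of {P}"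
    using assms spectral_crepD(1)[OF X] closure_of_subset[of "{P}" T] by auto
  ultimately show "specializes_to T P Q"
    unfolding specializes_to_def
    using spectral_crep_closedin_upward[OF X closedin_closure_of] assms(3) by blast
qed

lemma Min_of_spectral_crep:
  assumes X: "spectral_crep A C D X T" and "Y \<subseteq> X"
  shows "Min_of T Y = {P \<in> Y. \<forall>Q\<in>Y. Q \<subseteq> P \<longrightarrow> Q = P}"
proof -
  have "specializes_to T Q P \<longleftrightarrow> Q \<subseteq> P" if "P \<in> Y" "Q \<in> Y" for P Q
    by (rule specializes_to_iff_subset[OF X]) (use that assms(2) in auto)
  then show ?thesis by (simp add: Min_of_def cong: conj_cong)
qed

lemma spectral_crep_closedin_V_set:
  assumes X: "spectral_crep A C D X T" and "F \<subseteq> D"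
  shows "closedin T (V_set X F)"
proof -
  note XD = spectral_crepD[OF X]
  have "X - V_set X F = (\<Union>d\<in>F. U_set X {d})" by (auto simp: V_set_def U_set_def)
  moreover have "openin T (\<Union>d\<in>F. U_set X {d})" using assms(2) XD(6) by blast
  ultimately show ?thesis using XD(1) by (auto simp: closedin_def V_set_def)
qed

section \<open>Compactness and minimal members of closed sets\<close>

text \<open>Disjointness from \<open>E\<close> means lying in U(d) for every
  \<open>d \<in> E\<close>, so this is \<open>spectral_space_fip\<close> for these quasicompact open
  sets. In this form compactness yields members of \<open>Y\<close> from finite conditions.\<close>

lemma spectral_crep_avoid:
  assumes X: "spectral_crep A C D X T" and Y: "closedin T Y" and "E \<subseteq> D"
    and fin: "\<And>G. finite G \<Longrightarrow> G \<subseteq> E \<Longrightarrow> \<exists>P\<in>Y. P \<inter> G = {}"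
  shows "\<exists>P\<in>Y. P \<inter> E = {}"
proof -
  note XD = spectral_crepD[OF X]
  have YX: "Y \<subseteq> X" using closedin_subset[OF Y] XD(1) by simp
  have fip: "Y \<inter> \<Inter>\<F> \<noteq> {}" if \<F>: "finite \<F>" "\<F> \<subseteq> (\<lambda>d. U_set X {d}) ` E" for \<F>
  proof -
    obtain G where G: "G \<subseteq> E" "finite G" "\<F> = (\<lambda>d. U_set X {d}) ` G"
      using finite_subset_image[OF \<F>] by metis
    then obtain P where "P \<in> Y" "P \<inter> G = {}" using fin by metis
    then have "P \<in> Y \<inter> \<Inter>\<F>" using YX G by (auto simp: U_set_def)
    then show ?thesis by blast
  qed
  obtain P where P: "P \<in> Y" "\<And>K. K \<in> (\<lambda>d. U_set X {d}) ` E \<Longrightarrow> P \<in> K"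
  proof (rule spectral_space_fip[OF XD(4) Y _ fip])
    show "openin T K \<and> compactin T K" if "K \<in> (\<lambda>d. U_set X {d}) ` E" for K
      using that XD(6) \<open>E \<subseteq> D\<close> by blast
  qed (use that in blast)+
  show ?thesis by (rule bexI[OF _ P(1)]) (use P(2) in \<open>auto simp: U_set_def\<close>)
qed

text \<open>Zorn's lemma among the members of \<open>Y\<close> contained in \<open>P\<close>. The
  intersection of a chain is not known to belong to \<open>Y\<close>, so the lower bound comes from
  compactness, as a member of \<open>Y\<close> avoiding \<open>D - \<Inter>\<C>\<close>.\<close>

lemma spectral_crep_minimal_below:
  assumes X: "spectral_crep A C D X T" and Y: "closedin T Y" and "P \<in> Y"
  obtains Q where "Q \<in> Min_of T Y" "Q \<subseteq> P"
proof -
  note XD = spectral_crepD[OF X]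
  have YX: "Y \<subseteq> X" using closedin_subset[OF Y] XD(1) by simp
  obtain Q where Q: "Q \<in> {Q \<in> Y. Q \<subseteq> P}"
    and Q_min: "\<And>R. R \<in> {Q \<in> Y. Q \<subseteq> P} \<Longrightarrow> R \<subseteq> Q \<Longrightarrow> R = Q"
  proof (rule Zorn_descending[of "{Q \<in> Y. Q \<subseteq> P}"])
    fix \<C>
    assume \<C>: "\<C> \<subseteq> {Q \<in> Y. Q \<subseteq> P}" and chain: "\<And>a b. a \<in> \<C> \<Longrightarrow> b \<in> \<C> \<Longrightarrow> a \<subseteq> b \<or> b \<subseteq> a"
    show "\<exists>L\<in>{Q \<in> Y. Q \<subseteq> P}. \<forall>c\<in>\<C>. L \<subseteq> c"
    proof (cases "\<C> = {}")
      case True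
      then show ?thesis using \<open>P \<in> Y\<close> by blast
    next
      case False
      have fin: "\<exists>R\<in>Y. R \<inter> G = {}" if G: "finite G" "G \<subseteq> D - \<Inter>\<C>" for G
      proof -
        \<comment> \<open>Each \<open>g\<close> is omitted by some chain member \<open>c g\<close>;
          as \<open>G\<close> is finite, the smallest of these omits all of
          \<open>G\<close>.\<close>
        have "\<exists>c. \<forall>g\<in>G. c g \<in> \<C> \<and> g \<notin> c g" using G(2) by (intro bchoice) blast
        then obtain c where c: "\<forall>g\<in>G. c g \<in> \<C> \<and> g \<notin> c g" ..
        show ?thesis
        proof (cases "G = {}")
          case True
          then show ?thesis using \<open>P \<in> Y\<close> by blast
        next
          case False
          have "\<Inter>(c ` G) \<in> c ` G"
          proof (rule finite_chain_Inter_mem)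
            fix a b
            assume "a \<in> c ` G" "b \<in> c ` G"
            then have "a \<in> \<C>" "b \<in> \<C>" using c by force+
            then show "a \<subseteq> b \<or> b \<subseteq> a" by (rule chain)
          qed (use G(1) False in simp_all)
          then obtain g where g: "\<Inter>(c ` G) = c g" "g \<in> G" by (rule imageE)
          have "c g \<in> \<C>" using c g(2) by simp
          with \<C> have "c g \<in> {Q \<in> Y. Q \<subseteq> P}" by (rule subsetD)
          then have "c g \<in> Y" by simp
          moreover have "c g \<inter> G = {}"
          proof -
            have "h \<notin> c g" if "h \<in> G" for h
            proof
              assume "h \<in> c g"
              then have "h \<in> \<Inter>(c ` G)" unfolding g(1) .
              then have "h \<in> c h" using that by (rule INT_D)
              then show False using c that by simp
            qed
            then show ?thesis by auto
          qed
          ultimately show ?thesis by (rule bexI[rotated])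
        qed
      qed
      have "\<exists>L\<in>Y. L \<inter> (D - \<Inter>\<C>) = {}"
        by (rule spectral_crep_avoid[OF X Y Diff_subset]) (erule (1) fin)
      then obtain L where L: "L \<in> Y" "L \<inter> (D - \<Inter>\<C>) = {}" ..
      \<comment> \<open>For a subset of \<open>D\<close>, avoiding \<open>D - \<Inter>\<C>\<close>
        amounts to lying inside \<open>\<Inter>\<C>\<close>.\<close>
      have "L \<subseteq> D" using L(1) YX XD(2) by auto
      then have "L \<subseteq> \<Inter>\<C>" using L(2) by blast
      moreover have "\<Inter>\<C> \<subseteq> P" using False \<C> by blast
      ultimately have "L \<in> {Q \<in> Y. Q \<subseteq> P}" using L(1) by simp
      then show ?thesis
      proof (rule bexI[rotated], intro ballI)
        show "L \<subseteq> c" if "c \<in> \<C>" for c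
          using \<open>L \<subseteq> \<Inter>\<C>\<close> Inter_lower[OF that] by (rule order_trans)
      qed
    qed
  qed (rule that)
  have "Q \<in> Min_of T Y"
    unfolding Min_of_spectral_crep[OF X YX]
  proof (intro CollectI conjI ballI impI)
    fix R
    assume "R \<in> Y" "R \<subseteq> Q"
    then show "R = Q" using Q by (intro Q_min) auto
  qed (use Q in simp)
  then show ?thesis by (rule that) (use Q in simp)
qed

text \<open>Every member of \<open>Y\<close> contains a minimal one, so discarding the others leaves
  the intersection unchanged. This is why \<open>Min_of T Y\<close> represents \<open>A\<close>
  whenever the closed set \<open>Y\<close> does.\<close>

lemma Inter_Min_of:
  assumes X: "spectral_crep A C D X T" and Y: "closedin T Y"
  shows "\<Inter>(Min_of T Y) = \<Inter>Y"
proof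
  show "\<Inter>(Min_of T Y) \<subseteq> \<Inter>Y"
  proof (rule Inter_greatest)
    fix P
    assume "P \<in> Y"
    then obtain Q where Q: "Q \<in> Min_of T Y" "Q \<subseteq> P" by (rule spectral_crep_minimal_below[OF X Y])
    show "\<Inter>(Min_of T Y) \<subseteq> P" using Inter_lower[OF Q(1)] Q(2) by (rule order_trans)
  qed
  have "Min_of T Y \<subseteq> Y" unfolding Min_of_def by (rule Collect_restrict)
  then show "\<Inter>Y \<subseteq> \<Inter>(Min_of T Y)" by (rule Inter_anti_mono)
qed

section \<open>The spectral and patch topologies on minimal members\<close>

text \<open>\<open>G\<close> describes a spectral neighbourhood of \<open>B\<close>, the members
  disjoint from \<open>G\<close>. Were there no such \<open>G\<close>, compactness applied to
  \<open>insert d (D - B)\<close> would give a member of \<open>Y\<close> inside \<open>B\<close>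
  without \<open>d\<close>, against the minimality of \<open>B\<close>.\<close>

lemma Min_of_avoid_nbhd:
  assumes X: "spectral_crep A C D X T" and Y: "closedin T Y" and B: "B \<in> Min_of T Y" and "d \<in> B"
  shows "\<exists>G. finite G \<and> G \<subseteq> D - B \<and> (\<forall>P\<in>Y. P \<inter> G = {} \<longrightarrow> d \<in> P)"
proof (rule ccontr)
  assume not_thesis: "\<not> ?thesis"
  note XD = spectral_crepD[OF X]
  have YX: "Y \<subseteq> X" using closedin_subset[OF Y] XD(1) by simp
  have BY: "B \<in> Y" and B_min: "\<And>Q. Q \<in> Y \<Longrightarrow> Q \<subseteq> B \<Longrightarrow> Q = B"
    using B unfolding Min_of_spectral_crep[OF X YX] by auto
  then have "B \<subseteq> D" using YX XD(2) by auto
  have fin: "\<exists>P\<in>Y. P \<inter> G = {}" if G: "finite G" "G \<subseteq> insert d (D - B)" for G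
  proof -
    \<comment> \<open>The negated claim concerns only sets outside \<open>B\<close>, so
      \<open>d\<close> is removed from \<open>G\<close> first. The resulting \<open>P\<close> omits
      \<open>d\<close> as well, hence avoids all of \<open>G\<close>.\<close>
    have "finite (G - {d})" "G - {d} \<subseteq> D - B" using G by auto
    with not_thesis have "\<not> (\<forall>P\<in>Y. P \<inter> (G - {d}) = {} \<longrightarrow> d \<in> P)" by simp
    then obtain P where P: "P \<in> Y" "P \<inter> (G - {d}) = {}" "d \<notin> P" by auto
    then have "P \<inter> G = {}" by auto
    with P(1) show ?thesis ..
  qed
  have "insert d (D - B) \<subseteq> D" using \<open>B \<subseteq> D\<close> \<open>d \<in> B\<close> by auto
  then have "\<exists>P\<in>Y. P \<inter> insert d (D - B) = {}"
    by (rule spectral_crep_avoid[OF X Y]) (erule (1) fin)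
  then obtain P where P: "P \<in> Y" "P \<inter> insert d (D - B) = {}" ..
  have "P \<subseteq> B" using P YX XD(2) by blast
  with B_min P(1) have "P = B" by blast
  then show False using P(2) \<open>d \<in> B\<close> by blast
qed

text \<open>By quasicompactness there are finitely many elements of \<open>B\<close> such that each
  member of \<open>U\<close> omits at least one of them. By \<open>Min_of_avoid_nbhd\<close> all of
  them are present throughout \<open>Y\<close> on a spectral neighbourhood of \<open>B\<close>,
  which therefore misses \<open>U\<close> on \<open>Y\<close>.\<close>

lemma openin_Min_of_compl:
  assumes X: "spectral_crep A C D X T" and Y: "closedin T Y"
    and U: "openin T U" "compactin T U"
  shows "openin (subtopology T (Min_of T Y)) (Min_of T Y - U)"
proof (rule openin_subopen[THEN iffD2], rule ballI)
  note XD = spectral_crepD[OF X]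
  have YX: "Y \<subseteq> X" using closedin_subset[OF Y] XD(1) by simp
  have ZY: "Min_of T Y \<subseteq> Y" by (auto simp: Min_of_def)
  fix B
  assume B: "B \<in> Min_of T Y - U"
  have BX: "B \<in> X" using B ZY YX by auto
  then have BD: "B \<subseteq> D" using XD(2) by auto
  \<comment> \<open>Some neighbourhood of \<open>P\<close> inside \<open>U\<close> is given by
    avoiding \<open>G\<close>. As \<open>B\<close> is not in \<open>U\<close>, it meets
    \<open>G\<close>, and a common element belongs to \<open>B\<close> but not to
    \<open>P\<close>.\<close>
  have "U \<subseteq> \<Union>((\<lambda>d. U_set X {d}) ` B)"
  proof
    fix P
    assume "P \<in> U"
    then obtain G where G: "G \<subseteq> D" "G \<inter> P = {}" "\<And>Q. Q \<in> X \<Longrightarrow> Q \<inter> G = {} \<Longrightarrow> Q \<in> U"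
      using spectral_crep_nbhd[OF X U(1)] by metis
    then obtain d where "d \<in> G" "d \<in> B" using B BX by blast
    moreover have "P \<in> X" using \<open>P \<in> U\<close> openin_subset[OF U(1)] XD(1) by auto
    ultimately show "P \<in> \<Union>((\<lambda>d. U_set X {d}) ` B)" using G(2) by (auto simp: U_set_def)
  qed
  then have "\<exists>\<F>. finite \<F> \<and> \<F> \<subseteq> (\<lambda>d. U_set X {d}) ` B \<and> U \<subseteq> \<Union>\<F>"
    by (rule compactinD[OF U(2), rotated]) (use XD(6) BD in auto)
  then obtain \<F> where \<F>: "finite \<F>" "\<F> \<subseteq> (\<lambda>d. U_set X {d}) ` B" "U \<subseteq> \<Union>\<F>"
    by (elim exE conjE)
  obtain S where S: "S \<subseteq> B" "finite S" "U \<subseteq> \<Union>((\<lambda>d. U_set X {d}) ` S)"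
    using finite_subset_image[OF \<F>(1,2)] \<F>(3) by metis
  have "\<forall>d\<in>S. \<exists>G. finite G \<and> G \<subseteq> D - B \<and> (\<forall>P\<in>Y. P \<inter> G = {} \<longrightarrow> d \<in> P)"
  proof
    fix d
    assume "d \<in> S"
    with S(1) have "d \<in> B" by (rule subsetD)
    with DiffD1[OF B] show "\<exists>G. finite G \<and> G \<subseteq> D - B \<and> (\<forall>P\<in>Y. P \<inter> G = {} \<longrightarrow> d \<in> P)"
      by (rule Min_of_avoid_nbhd[OF X Y])
  qed
  from bchoice[OF this] obtain g where
    g: "\<forall>d\<in>S. finite (g d) \<and> g d \<subseteq> D - B \<and> (\<forall>P\<in>Y. P \<inter> g d = {} \<longrightarrow> d \<in> P)" ..
  \<comment> \<open>Avoiding \<open>?G\<close> means avoiding every \<open>g d\<close>, which forces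
    a member of \<open>Y\<close> to contain all of \<open>S\<close>.\<close>
  let ?G = "\<Union>(g ` S)"
  let ?N = "Min_of T Y \<inter> {P \<in> X. P \<inter> ?G = {}}"
  have fin_G: "finite ?G" by (rule finite_UN_I[OF S(2)]) (use g in simp)
  have G_sub: "?G \<subseteq> D - B" by (rule UN_least) (use g in simp)
  then have "?G \<subseteq> D" by (rule order_trans) (rule Diff_subset)
  with fin_G have "openin T {P \<in> X. P \<inter> ?G = {}}"
    by (rule spectral_crep_openin_avoid[OF X])
  then have "openin (subtopology T (Min_of T Y)) ?N"
    by (rule openin_subtopology_Int2)
  moreover have "B \<in> ?N" using B BX G_sub by auto
  moreover have "?N \<subseteq> Min_of T Y - U"
  proof
    fix P
    assume P: "P \<in> ?N"
    have "P \<notin> U"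
    proof
      assume "P \<in> U"
      then obtain d where d: "d \<in> S" "d \<notin> P" using S(3) by (auto simp: U_set_def)
      have "P \<inter> g d = {}" using P d(1) by auto
      moreover have "P \<in> Y" using P ZY by auto
      ultimately show False using g d by simp
    qed
    with P show "P \<in> Min_of T Y - U" by simp
  qed
  ultimately show "\<exists>W. openin (subtopology T (Min_of T Y)) W \<and> B \<in> W \<and> W \<subseteq> Min_of T Y - U"
    by (intro exI[of _ ?N] conjI)
qed

text \<open>The patch subbase lists only quasicompact open sets and their complements, so the
  refinement is checked on the sets U(d), which generate \<open>T\<close> and are quasicompact
  open.\<close>

lemma openin_patch_topology:
  assumes X: "spectral_crep A C D X T" and "openin T U"
  shows "openin (patch_topology T) U"
proof (rule minimal_topology_subbase)
  note XD = spectral_crepD[OF X]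
  show "openin (topology (arbitrary union_of (finite intersection_of
      (\<lambda>U. U \<in> {U_set X {d} | d. d \<in> D}) relative_to topspace T))) U"
    using assms(2) XD(5) unfolding openin_subbase subbase_for_def by simp
  show "openin (patch_topology T) (topspace T)"
    using openin_topspace[of "patch_topology T"] unfolding patch_topology_def topspace_subbase .
  fix S
  assume "S \<in> {U_set X {d} | d. d \<in> D}"
  then obtain d where d: "d \<in> D" "S = U_set X {d}" by blast
  then have S: "openin T S" "compactin T S" using XD(6)[OF d(1)] by simp_all
  have "(finite intersection_of
        (\<lambda>S. \<exists>U. openin T U \<and> compactin T U \<and> (S = U \<or> S = topspace T - U))
      relative_to topspace T) (topspace T \<inter> S)"
    by (intro relative_to_inc finite_intersection_of_inc exI[of _ S]) (simp add: S)
  moreover have "topspace T \<inter> S = S" using openin_subset[OF S(1)] by auto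
  ultimately have "(finite intersection_of
        (\<lambda>S. \<exists>U. openin T U \<and> compactin T U \<and> (S = U \<or> S = topspace T - U))
      relative_to topspace T) S" by simp
  then show "openin (patch_topology T) S"
    unfolding patch_topology_def openin_subbase by (rule arbitrary_union_of_inc)
qed

lemma subtopology_patch_Min_of:
  assumes X: "spectral_crep A C D X T" and Y: "closedin T Y"
  shows "subtopology T (Min_of T Y) = subtopology (patch_topology T) (Min_of T Y)"
proof (rule topology_eq[THEN iffD2], intro allI iffI)
  let ?Z = "Min_of T Y"
  have ZX: "?Z \<subseteq> topspace T" using closedin_subset[OF Y] by (auto simp: Min_of_def)
  fix S
  show "openin (subtopology (patch_topology T) ?Z) S" if "openin (subtopology T ?Z) S"
    using that openin_patch_topology[OF X] unfolding openin_subtopology by blast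
  assume "openin (subtopology (patch_topology T) ?Z) S"
  then obtain U where U: "openin (patch_topology T) U" "S = U \<inter> ?Z"
    unfolding openin_subtopology by blast
  \<comment> \<open>Continuity of the identity need only be tested on the patch subbase, where
    complements are handled by \<open>openin_Min_of_compl\<close>.\<close>
  have "continuous_map (subtopology T ?Z) (patch_topology T) (\<lambda>P. P)"
    unfolding patch_topology_def
  proof (rule continuous_map_into_topology_subbase)
    fix S
    assume "\<exists>U. openin T U \<and> compactin T U \<and> (S = U \<or> S = topspace T - U)"
    then obtain U where U: "openin T U" "compactin T U" "S = U \<or> S = topspace T - U" by blast
    have "{P \<in> topspace (subtopology T ?Z). P \<in> S} = ?Z \<inter> S" using ZX by auto
    moreover have "openin (subtopology T ?Z) (?Z \<inter> S)"
      using U(3)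
    proof
      assume "S = U"
      then show ?thesis using U(1) by (simp add: openin_subtopology_Int2)
    next
      assume "S = topspace T - U"
      then have "?Z \<inter> S = ?Z - U" using ZX by blast
      then show ?thesis using openin_Min_of_compl[OF X Y U(1,2)] by simp
    qed
    ultimately show "openin (subtopology T ?Z) {P \<in> topspace (subtopology T ?Z). P \<in> S}" by simp
  qed auto
  then have "openin (subtopology T ?Z) {P \<in> topspace (subtopology T ?Z). P \<in> U}"
    using U(1) by (rule openin_continuous_map_preimage)
  moreover have "{P \<in> topspace (subtopology T ?Z). P \<in> U} = S" using ZX U(2) by auto
  ultimately show "openin (subtopology T ?Z) S" by simp
qed

section \<open>Irredundance\<close>

text \<open>Larger families have smaller intersections: the trace of \<open>\<Inter>W'\<close> on
  \<open>C\<close> is squeezed between those of \<open>\<Inter>Y\<close> and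
  \<open>\<Inter>W\<close>, both equal to \<open>A\<close>. Serves to enlarge a representation
  within \<open>Y\<close>.\<close>

lemma crep_between:
  assumes "crep A C D W" "crep A C D Y" "W \<subseteq> W'" "\<Inter>Y \<subseteq> \<Inter>W'" "W' \<subseteq> Pow D"
  shows "crep A C D W'"
proof -
  have A: "A = D \<inter> \<Inter>W \<inter> C" "A = D \<inter> \<Inter>Y \<inter> C" using assms(1,2) unfolding crep_def by simp_all
  have "D \<inter> \<Inter>W' \<inter> C \<subseteq> D \<inter> \<Inter>W \<inter> C"
    by (intro Int_mono order_refl Inter_anti_mono assms(3))
  moreover have "D \<inter> \<Inter>Y \<inter> C \<subseteq> D \<inter> \<Inter>W' \<inter> C"
    by (intro Int_mono order_refl assms(4))
  ultimately have "A = D \<inter> \<Inter>W' \<inter> C"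
    unfolding A(1)[symmetric] A(2)[symmetric] by (rule subset_antisym[rotated])
  then show ?thesis using assms(5) unfolding crep_def by (intro conjI)
qed

lemma isolated_imp_strongly_irredundant_in:
  assumes X: "spectral_crep A C D X T" and min: "minimal_closed_crep A C D T Y"
    and B: "B \<in> Min_of T Y" and iso: "openin (subtopology T (Min_of T Y)) {B}"
  shows "strongly_irredundant_in A C D T (Min_of T Y) B"
proof -
  note XD = spectral_crepD[OF X]
  let ?Z = "Min_of T Y" and ?V = "V_set X B"
  have Y: "closedin T Y" "crep A C D Y"
    using min unfolding minimal_closed_crep_def by simp_all
  have Y_min: "Y' = Y" if "closedin T Y'" "crep A C D Y'" "Y' \<subseteq> Y" for Y'
    using min that unfolding minimal_closed_crep_def by metis
  have YX: "Y \<subseteq> X" using closedin_subset[OF Y(1)] XD(1) by simp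
  have ZY: "?Z \<subseteq> Y" by (auto simp: Min_of_def)
  have BX: "B \<in> X" using B ZY YX by auto
  have VY: "?V \<subseteq> Y"
    using spectral_crep_closedin_upward[OF X Y(1)] B ZY by (auto simp: V_set_def)
  have V_closed: "closedin T ?V"
    using spectral_crep_closedin_V_set[OF X] BX XD(2) by auto
  have crep_Z: "crep A C D ?Z"
    using Y(2) Inter_Min_of[OF X Y(1)] ZY unfolding crep_def by auto
  have YPow: "Y \<subseteq> Pow D" using YX XD(2) by auto
  obtain U where U: "openin T U" "{B} = U \<inter> ?Z" using iso unfolding openin_subtopology by blast
  \<comment> \<open>Strong irredundance is encoded as an equivalence, so \<open>?V\<close> itself
    must be shown to qualify.\<close>
  have crep_V: "crep A C D (?Z - {B} \<union> ?V)"
  proof (rule crep_between[OF crep_Z Y(2)])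
    show "?Z \<subseteq> ?Z - {B} \<union> ?V" using BX by (auto simp: V_set_def)
    have sub: "?Z - {B} \<union> ?V \<subseteq> Y" using ZY VY by blast
    show "\<Inter>Y \<subseteq> \<Inter>(?Z - {B} \<union> ?V)" by (rule Inter_anti_mono[OF sub])
    show "?Z - {B} \<union> ?V \<subseteq> Pow D" using sub YPow by blast
  qed
  have V_only: "W = ?V" if W: "closedin T W" "W \<subseteq> ?V" "crep A C D (?Z - {B} \<union> W)" for W
  proof (rule ccontr)
    assume "W \<noteq> ?V"
    \<comment> \<open>Closed sets are closed upward, so containing \<open>B\<close> would make
      \<open>W\<close> all of \<open>?V\<close>.\<close>
    then have "B \<notin> W"
      using spectral_crep_closedin_upward[OF X W(1)] W(2) by (auto simp: V_set_def)
    \<comment> \<open>Deleting \<open>U\<close> removes \<open>B\<close> but no other member of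
      \<open>?Z\<close>, so \<open>?Y'\<close> still contains the representation
      \<open>?Z - {B} \<union> W\<close>, while it lacks \<open>B\<close>.\<close>
    let ?Y' = "Y - U \<union> W"
    have sub: "?Y' \<subseteq> Y" using W(2) VY by blast
    have "crep A C D ?Y'"
    proof (rule crep_between[OF W(3) Y(2)])
      show "?Z - {B} \<union> W \<subseteq> ?Y'" using U(2) ZY by blast
      show "\<Inter>Y \<subseteq> \<Inter>?Y'" by (rule Inter_anti_mono[OF sub])
      show "?Y' \<subseteq> Pow D" using sub YPow by blast
    qed
    moreover have "closedin T ?Y'" using Y(1) U(1) W(1) by (intro closedin_Un closedin_diff)
    ultimately have "?Y' = Y" using Y_min sub by blast
    then show False using \<open>B \<notin> W\<close> U(2) B ZY by blast
  qed
  have "closedin (subtopology T ?V) W \<longleftrightarrow> closedin T W \<and> W \<subseteq> ?V" for W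
    by (rule closedin_closed_subtopology[OF V_closed])
  then show ?thesis
    unfolding strongly_irredundant_in_def XD(1) using V_closed crep_V V_only by auto
qed

theorem theorem3p6:
  fixes A C D :: "'a set" and X Z :: "'a set set" and T :: "'a set topology"
  assumes "A \<noteq> {}" and "A \<subset> C" and "C \<subseteq> D"
    and "spectral_crep A C D X T"
    and "minimal_crep A C D T Z"
  shows "subtopology T Z = subtopology (patch_topology T) Z \<and>
    (\<forall>B\<in>Z.
      (irredundant_in A C D Z B \<longleftrightarrow> strongly_irredundant_in A C D T Z B) \<and>
      (strongly_irredundant_in A C D T Z B \<longleftrightarrow> openin (subtopology T Z) {B}) \<and>
      (openin (subtopology T Z) {B} \<longleftrightarrow> openin (subtopology (patch_topology T) Z) {B}))"
proof -
  note X = assms(4) and XD = spectral_crepD[OF assms(4)]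
  obtain Y where min: "minimal_closed_crep A C D T Y" and Z: "Z = Min_of T Y"
    using assms(5) unfolding minimal_crep_def by (elim exE conjE)
  have Y: "closedin T Y" "crep A C D Y" using min unfolding minimal_closed_crep_def by simp_all
  have ZY: "Z \<subseteq> Y" unfolding Z by (auto simp: Min_of_def)
  have ZX: "Z \<subseteq> X" using ZY closedin_subset[OF Y(1)] XD(1) by auto
  have crep_Z: "crep A C D Z"
    using Y(2) ZY unfolding crep_def Z Inter_Min_of[OF X Y(1)]
    by (elim conjE, intro conjI) (rule order_trans)
  have topologies: "subtopology T Z = subtopology (patch_topology T) Z"
    unfolding Z by (rule subtopology_patch_Min_of[OF X Y(1)])
  \<comment> \<open>If \<open>Z - {B}\<close> were a representation, the empty set would be an
    admissible replacement for \<open>B\<close>, yet it differs from \<open>V_set X B\<close>, which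
    contains \<open>B\<close>.\<close>
  have strong_irr: "irredundant_in A C D Z B"
    if "B \<in> Z" "strongly_irredundant_in A C D T Z B" for B
  proof -
    have "B \<in> V_set X B" using that ZX by (auto simp: V_set_def)
    then have "{} \<noteq> V_set X B" by blast
    then show ?thesis
      using that(2) unfolding strongly_irredundant_in_def irredundant_in_def XD(1)
      by (metis closedin_empty sup_bot.right_neutral)
  qed
  have irr_iso: "openin (subtopology T Z) {B}" if "B \<in> Z" and irr: "irredundant_in A C D Z B" for B
  proof -
    have A_eq: "A = D \<inter> \<Inter>Z \<inter> C" and ZPow: "Z \<subseteq> Pow D" using crep_Z unfolding crep_def by simp_all
    have "Z - {B} \<subseteq> Pow D" using ZPow by auto
    then have "A \<noteq> D \<inter> \<Inter>(Z - {B}) \<inter> C"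
      using irr unfolding irredundant_in_def crep_def by simp
    moreover have "A \<subseteq> D \<inter> \<Inter>(Z - {B}) \<inter> C" using A_eq by auto
    ultimately have "\<not> D \<inter> \<Inter>(Z - {B}) \<inter> C \<subseteq> A" by (metis subset_antisym)
    \<comment> \<open>Dropping \<open>B\<close> strictly enlarges the intersection within
      \<open>C\<close>. A new element \<open>c\<close> lies in every other member of
      \<open>Z\<close> but not in \<open>B\<close>, so U(c) cuts out exactly
      \<open>{B}\<close>.\<close>
    then obtain c where c: "c \<in> D \<inter> \<Inter>(Z - {B}) \<inter> C" "c \<notin> A" unfolding subset_iff by metis
    have "c \<notin> B"
    proof
      assume "c \<in> B"
      then have "c \<in> \<Inter>Z" using c(1) by auto
      then show False using c A_eq by simp
    qed
    then have "Z \<inter> U_set X {c} = {B}" using c(1) that(1) ZX by (auto simp: U_set_def)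
    moreover have "openin (subtopology T Z) (Z \<inter> U_set X {c})"
      using XD(6)[of c] c(1) by (simp add: openin_subtopology_Int2)
    ultimately show ?thesis by simp
  qed
  have iso_strong: "strongly_irredundant_in A C D T Z B"
    if "B \<in> Z" "openin (subtopology T Z) {B}" for B
    using isolated_imp_strongly_irredundant_in[OF X min] that unfolding Z .
  \<comment> \<open>The implications close a cycle: irredundant, isolated, strongly irredundant,
    irredundant. Patch isolation follows from the equality of the two subspace topologies.\<close>
  show ?thesis
  proof (intro conjI ballI)
    fix B
    assume B: "B \<in> Z"
    show "irredundant_in A C D Z B \<longleftrightarrow> strongly_irredundant_in A C D T Z B"
      using strong_irr[OF B] irr_iso[OF B] iso_strong[OF B] by argo
    show "strongly_irredundant_in A C D T Z B \<longleftrightarrow> openin (subtopology T Z) {B}"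
      using strong_irr[OF B] irr_iso[OF B] iso_strong[OF B] by argo
    show "openin (subtopology T Z) {B} \<longleftrightarrow> openin (subtopology (patch_topology T) Z) {B}"
      unfolding topologies ..
  qed (rule topologies)
qed

end
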